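(* Let $G=\mathrm{SL}(2,\mathbb{Z})$, $S=\begin{pmatrix}0&-1\\1&0\end{pmatrix}$, $T=\begin{pmatrix}1&1\\0&1\end{pmatrix}$. For a rational number $r$ with regular continued fraction $r=[a_1,\dots,a_n]$ put $$N(r)=T^{a_1}ST^{-a_2}S\cdots T^{(-1)^{n-1}a_n}S\in G .$$ (1) Let $L=\{N(r)\,T^{l} : r\in\mathbb{Q},\ l\in\mathbb{Z}\}$. A complete set of representatives of the left cosets of $G^S$ in $G$ (exactly one element from each coset) is obtained from $L$ by removing repetitions of the following kind: whenever both $g=\begin{pmatrix}a&b\\c&d\end{pmatrix}$ and $gS=\begin{pmatrix}b&-a\\d&-c\end{pmatrix}$ (which represent the same left coset of $G^S$) belong to $L$, only one of the two is kept. (2) Let $L'=\{T^m : m\in\mathbb{Z}\}\cup\{N(r)\,T^{l} : r\in\mathbb{Q}\setminus\mathbb{Z},\ l\in\mathbb{Z}\}$. A complete set of representatives of the left cosets of $G^{ST}$ in $G$ (exactly one element from each coset) is obtained from $L'$ by removing repetitions of the following kind: whenever several elements of $L'$ lie in one and the same coset $gG^{ST}=\{\pm g,\ \pm gST,\ \pm g(ST)^2\}$, only one of them is kept. (3) A complete set of representatives of the left cosets of $G^{T}$ in $G$ (exactly one element from each coset) is given by $I$ together with the elements $N(r)$, $r\in\mathbb{Q}$.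
   Context: For $g\in G$, $G^g=\{h\in G : hg=gh\}$ is the centralizer of $g$; left cosets of $G^g$ are the sets $hG^g$. $I$ is the identity matrix. $[a_1,a_2,\dots,a_n]$ denotes the continued fraction $a_1+\frac{1}{a_2+\frac{1}{\cdots+\frac{1}{a_n}}}$; it is called regular if $a_1\in\mathbb{Z}$ and $a_2,\dots,a_n$ are positive integers. Every rational number has exactly two expressions as a regular continued fraction, one of which ends in an extra final $1$; convention: the regular continued fraction of a rational number means the unique one with $n\ge 1$ and with $a_n>1$ whenever $n\geq 2$. *)

theory Defs
  imports "HOL-Analysis.Analysis" "HOL-Algebra.Left_Coset"
begin

definition SL2Z :: "(int^2^2) monoid" where
  "SL2Z = \<lparr>carrier = {A. det A = 1}, mult = (**), one = mat 1\<rparr>"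

definition mat2 :: "int \<Rightarrow> int \<Rightarrow> int \<Rightarrow> int \<Rightarrow> int^2^2" where
  "mat2 a b c d = vector [vector [a, b], vector [c, d]]"

definition S_mat :: "int^2^2" where "S_mat = mat2 0 (-1) 1 0"

definition T_mat :: "int^2^2" where "T_mat = mat2 1 1 0 1"

text \<open>The group operation has to be used for powers as well: the type class operations
  \<open>*\<close> and \<open>^\<close> act entrywise on \<^typ>\<open>int^2^2\<close>.\<close>

abbreviation T_pow :: "int \<Rightarrow> int^2^2" where
  "T_pow k \<equiv> T_mat [^]\<^bsub>SL2Z\<^esub> k"

definition centralizer :: "('a, 'b) monoid_scheme \<Rightarrow> 'a \<Rightarrow> 'a set" where
  "centralizer G g = {h \<in> carrier G. h \<otimes>\<^bsub>G\<^esub> g = g \<otimes>\<^bsub>G\<^esub> h}"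

definition left_coset_representatives ::
    "('a, 'b) monoid_scheme \<Rightarrow> 'a set \<Rightarrow> 'a set \<Rightarrow> bool" where
  "left_coset_representatives G H R \<longleftrightarrow>
     R \<subseteq> carrier G \<and> (\<forall>C \<in> lcosets\<^bsub>G\<^esub> H. \<exists>!g. g \<in> R \<and> g \<in> C)"

text \<open>\<open>R\<close> arises from \<open>L\<close> by removing repetitions, where each member of \<open>K\<close> is a set of
  elements of \<open>L\<close> that repeat each other: exactly one element of each member of \<open>K\<close> is kept,
  and nothing else is removed.\<close>

definition removing_repetitions :: "'a set \<Rightarrow> 'a set set \<Rightarrow> 'a set \<Rightarrow> bool" where
  "removing_repetitions L K R \<longleftrightarrow>
     R \<subseteq> L \<and> (\<forall>C \<in> K. \<exists>!g. g \<in> R \<and> g \<in> C) \<and> (\<forall>g \<in> L. g \<notin> \<Union>K \<longrightarrow> g \<in> R)"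

text \<open>\<open>cf_value [a\<^sub>1, \<dots>, a\<^sub>n] = a\<^sub>1 + 1 / (a\<^sub>2 + 1 / (\<dots> + 1 / a\<^sub>n))\<close>; the value on the empty list
  is a dummy.\<close>

fun cf_value :: "int list \<Rightarrow> rat" where
  "cf_value [] = 0"
| "cf_value [a] = of_int a"
| "cf_value (a # b # as) = of_int a + 1 / cf_value (b # as)"

definition is_regular_cf :: "rat \<Rightarrow> int list \<Rightarrow> bool" where
  "is_regular_cf r as \<longleftrightarrow>
     as \<noteq> [] \<and> (\<forall>a \<in> set (tl as). a > 0) \<and> (length as \<ge> 2 \<longrightarrow> last as > 1) \<and> cf_value as = r"

definition regular_cf :: "rat \<Rightarrow> int list" where
  "regular_cf r = (THE as. is_regular_cf r as)"

text \<open>List indices start at \<open>0\<close>, so \<open>as ! i\<close> is \<open>a\<^sub>i\<^sub>+\<^sub>1\<close> and carries the sign \<open>(-1)\<^sup>i\<close>.\<close>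

definition cf_word :: "int list \<Rightarrow> int^2^2" where
  "cf_word as = foldr (\<lambda>i M. T_pow ((-1) ^ i * as ! i) \<otimes>\<^bsub>SL2Z\<^esub> S_mat \<otimes>\<^bsub>SL2Z\<^esub> M)
                  [0..<length as] \<one>\<^bsub>SL2Z\<^esub>"

definition N_mat :: "rat \<Rightarrow> int^2^2" where
  "N_mat r = cf_word (regular_cf r)"

end

theory Submission
  imports Defs
begin

text \<open>Let the modular group act on the projective line by Moebius transformations. The stabilizer of
  infinity is \<open>{T\<^sup>k, - T\<^sup>k} = G\<^sup>T\<close>, and unrolling the continued fraction shows that \<open>N r\<close> maps
  infinity to \<open>r\<close>; this gives (3). Hence every \<open>g\<close> not fixing infinity equals \<open>N r T\<^sup>l\<close> up to sign, for
  unique \<open>r\<close> and \<open>l\<close>, and exactly one of \<open>g\<close>, \<open>- g\<close> is of this form. The centralizers of \<open>S\<close> and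
  \<open>ST\<close> are finite and contain \<open>- I\<close>, so for (1) and (2) it remains to see that one of the points
  to which the elements of a coset map infinity is finite, respectively not an integer.\<close>

section \<open>Calculation with 2x2 matrices and the group structure of \<open>SL2Z\<close>\<close>

lemma mat2_nth [simp]:
  "mat2 a b c d $ 1 $ 1 = a" "mat2 a b c d $ 1 $ 2 = b"
  "mat2 a b c d $ 2 $ 1 = c" "mat2 a b c d $ 2 $ 2 = d"
  by (simp_all add: mat2_def)

lemma mat2_eq_iff [simp]:
  "mat2 a b c d = mat2 a' b' c' d' \<longleftrightarrow> a = a' \<and> b = b' \<and> c = c' \<and> d = d'"
  by (metis mat2_nth)

lemma mat2_exhaust: obtains a b c d where "A = mat2 a b c d"
proof
  show "A = mat2 (A $ 1 $ 1) (A $ 1 $ 2) (A $ 2 $ 1) (A $ 2 $ 2)"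
    by (simp add: vec_eq_iff forall_2)
qed

lemma uminus_mat2 [simp]: "- mat2 a b c d = mat2 (- a) (- b) (- c) (- d)"
  by (simp add: vec_eq_iff forall_2)

lemma SL2Z_mult_mat2 [simp]:
  "mat2 a b c d \<otimes>\<^bsub>SL2Z\<^esub> mat2 a' b' c' d' =
   mat2 (a * a' + b * c') (a * b' + b * d') (c * a' + d * c') (c * b' + d * d')"
  by (simp add: SL2Z_def vec_eq_iff forall_2 matrix_matrix_mult_def sum_2)

lemma SL2Z_one: "\<one>\<^bsub>SL2Z\<^esub> = mat2 1 0 0 1"
  by (simp add: SL2Z_def vec_eq_iff forall_2 mat_def)

lemma mat2_in_SL2Z [simp]: "mat2 a b c d \<in> carrier SL2Z \<longleftrightarrow> a * d - b * c = 1"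
  by (simp add: SL2Z_def det_2)

lemma SL2Z_cases:
  assumes "g \<in> carrier SL2Z"
  obtains a b c d where "g = mat2 a b c d" "a * d - b * c = 1"
  by (metis assms mat2_exhaust mat2_in_SL2Z)

interpretation SL2Z: group SL2Z
proof (rule groupI)
  fix x y assume "x \<in> carrier SL2Z" "y \<in> carrier SL2Z"
  then show "x \<otimes>\<^bsub>SL2Z\<^esub> y \<in> carrier SL2Z"
    by (simp add: SL2Z_def det_mul)
next
  show "\<one>\<^bsub>SL2Z\<^esub> \<in> carrier SL2Z"
    by (simp add: SL2Z_one)
next
  fix x y z
  show "x \<otimes>\<^bsub>SL2Z\<^esub> y \<otimes>\<^bsub>SL2Z\<^esub> z = x \<otimes>\<^bsub>SL2Z\<^esub> (y \<otimes>\<^bsub>SL2Z\<^esub> z)"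
    by (simp add: SL2Z_def matrix_mul_assoc)
next
  fix x
  show "\<one>\<^bsub>SL2Z\<^esub> \<otimes>\<^bsub>SL2Z\<^esub> x = x"
    by (simp add: SL2Z_def)
next
  fix x assume "x \<in> carrier SL2Z"
  then obtain a b c d where "x = mat2 a b c d" "a * d - b * c = 1"
    by (rule SL2Z_cases)
  then show "\<exists>y\<in>carrier SL2Z. y \<otimes>\<^bsub>SL2Z\<^esub> x = \<one>\<^bsub>SL2Z\<^esub>"
    by (intro bexI[of _ "mat2 d (- b) (- c) a"]) (auto simp: SL2Z_one algebra_simps)
qed

lemma S_mat_closed [simp]: "S_mat \<in> carrier SL2Z"
  by (simp add: S_mat_def)

lemma T_mat_closed [simp]: "T_mat \<in> carrier SL2Z"
  by (simp add: T_mat_def)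

lemma T_pow_eq: "T_pow k = mat2 1 k 0 1"
proof -
  have nat: "T_mat [^]\<^bsub>SL2Z\<^esub> n = mat2 1 (int n) 0 1" for n :: nat
    by (induction n) (simp_all add: SL2Z_one T_mat_def)
  have "inv\<^bsub>SL2Z\<^esub> mat2 1 m 0 1 = mat2 1 (- m) 0 1" for m
    by (rule SL2Z.inv_equality) (simp_all add: SL2Z_one)
  then show ?thesis
    by (simp add: int_pow_def2 nat)
qed

lemma T_pow_closed: "T_pow k \<in> carrier SL2Z"
  by (simp add: T_pow_eq)

section \<open>Centralizers, left cosets and the selection of one element per coset\<close>

lemma (in group) centralizer_subgroup:
  assumes "g \<in> carrier G"
  shows "subgroup (centralizer G g) G"
proof
  show "centralizer G g \<subseteq> carrier G" "\<one> \<in> centralizer G g"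
    using assms by (auto simp: centralizer_def)
next
  fix x y assume "x \<in> centralizer G g" "y \<in> centralizer G g"
  then show "x \<otimes> y \<in> centralizer G g"
    using assms by (simp add: centralizer_def) (metis m_assoc)
next
  fix x assume "x \<in> centralizer G g"
  then have x: "x \<in> carrier G" "x \<otimes> g = g \<otimes> x"
    by (auto simp: centralizer_def)
  then have "inv x \<otimes> g = g \<otimes> inv x"
    using assms by (metis inv_closed inv_solve_left inv_solve_right m_assoc m_closed)
  with x show "inv x \<in> centralizer G g"
    by (simp add: centralizer_def)
qed

lemma (in group) lcosets_eqI:
  assumes "subgroup H G" "C \<in> lcosets H" "D \<in> lcosets H" "g \<in> C" "g \<in> D"
  shows "C = D"
  using lcos_disjoint[OF assms(1-3)] assms(4,5) by blast

text \<open>Cosets partition the group, so the members of \<open>K\<close> are disjoint, and an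
  element of \<open>L\<close> outside all of them is alone in its coset. Removing repetitions thus
  leaves exactly one element in every coset, because \<open>L\<close> meets them all. Choosing one
  element of \<open>L\<close> per coset shows that a suitable \<open>R\<close> exists.\<close>

lemma (in group) removing_repetitions_lcosets:
  assumes H: "subgroup H G" and L: "L \<subseteq> carrier G"
    and meets: "\<And>C. C \<in> lcosets H \<Longrightarrow> L \<inter> C \<noteq> {}"
    and K: "K = {L \<inter> C | C. C \<in> lcosets H \<and> (\<exists>g \<in> L \<inter> C. \<exists>h \<in> L \<inter> C. g \<noteq> h)}"
  shows "(\<exists>R. removing_repetitions L K R) \<and>
         (\<forall>R. removing_repetitions L K R \<longrightarrow> left_coset_representatives G H R)"
proof (intro conjI allI impI)
  define f where "f C = (SOME g. g \<in> L \<inter> C)" for C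
  have f: "f C \<in> L \<inter> C" if "C \<in> lcosets H" for C
    unfolding f_def some_in_eq by (rule meets[OF that])
  have f_uniq: "f D = f C" if "C \<in> lcosets H" "D \<in> lcosets H" "f D \<in> C" for C D
    using lcosets_eqI[OF H that(1,2), of "f D"] f[OF that(2)] that(3) by simp
  have "removing_repetitions L K (f ` (lcosets H))"
    unfolding removing_repetitions_def
  proof (intro conjI ballI impI)
    show "f ` (lcosets H) \<subseteq> L"
      using f by blast
  next
    fix D assume "D \<in> K"
    then obtain C where C: "C \<in> lcosets H" "D = L \<inter> C"
      unfolding K by blast
    show "\<exists>!g. g \<in> f ` (lcosets H) \<and> g \<in> D"
    proof (rule ex1I[of _ "f C"])
      show "f C \<in> f ` (lcosets H) \<and> f C \<in> D"
        using C f[OF C(1)] by blast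
    next
      fix g assume "g \<in> f ` (lcosets H) \<and> g \<in> D"
      then obtain C' where "C' \<in> lcosets H" "g = f C'" "f C' \<in> C"
        using C(2) by blast
      then show "g = f C"
        using f_uniq[OF C(1)] by simp
    qed
  next
    fix g assume g: "g \<in> L" "g \<notin> \<Union> K"
    then obtain C where C: "C \<in> lcosets H" "g \<in> C"
      using L lcosets_part_G[OF H] by blast
    \<comment> \<open>Outside \<open>\<Union>K\<close>, \<open>g\<close> is the only element of
      \<open>L\<close> in its coset, so the choice function has to pick it.\<close>
    have "f C = g"
    proof (rule ccontr)
      assume "f C \<noteq> g"
      then have "L \<inter> C \<in> K"
        unfolding K using C g(1) f[OF C(1)] by blast
      then show False
        using g C(2) by blast
    qed
    with C show "g \<in> f ` (lcosets H)"
      by blast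
  qed
  then show "\<exists>R. removing_repetitions L K R" ..
next
  fix R assume "removing_repetitions L K R"
  then have R: "R \<subseteq> L" "\<And>C. C \<in> K \<Longrightarrow> \<exists>!g. g \<in> R \<and> g \<in> C"
    "\<And>g. g \<in> L \<Longrightarrow> g \<notin> \<Union>K \<Longrightarrow> g \<in> R"
    by (auto simp: removing_repetitions_def)
  show "left_coset_representatives G H R"
    unfolding left_coset_representatives_def
  proof (intro conjI ballI)
    show "R \<subseteq> carrier G"
      using R(1) L by blast
  next
    fix C assume C: "C \<in> lcosets H"
    show "\<exists>!g. g \<in> R \<and> g \<in> C"
    proof (cases "L \<inter> C \<in> K")
      case True
      then show ?thesis
        using R(2)[OF True] R(1) by blast
    next
      case False
      obtain g where g: "g \<in> L" "g \<in> C"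
        using meets[OF C] by blast
      have single: "h = g" if "h \<in> L" "h \<in> C" for h
      proof (rule ccontr)
        assume "h \<noteq> g"
        then have "L \<inter> C \<in> K"
          unfolding K using C g that by blast
        then show False
          using False by blast
      qed
      \<comment> \<open>By disjointness, a member of \<open>K\<close> containing \<open>g\<close>
        could only come from \<open>C\<close> itself.\<close>
      have "g \<notin> \<Union>K"
      proof
        assume "g \<in> \<Union>K"
        then obtain D where "L \<inter> D \<in> K" "D \<in> lcosets H" "g \<in> D"
          unfolding K by blast
        then show False
          using False lcosets_eqI[OF H C _ g(2)] by simp
      qed
      then have "g \<in> R"
        using R(3) g by blast
      then show ?thesis
        using single R(1) g by blast
    qed
  qed
qed

lemma l_coset_image: "g <#\<^bsub>G\<^esub> H = (\<lambda>h. g \<otimes>\<^bsub>G\<^esub> h) ` H"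
  by (auto simp: l_coset_def)

section \<open>The centralizers of \<open>S_mat\<close>, \<open>ST\<close> and
  \<open>T_mat\<close>\<close>

text \<open>Commuting with \<open>S_mat\<close> forces the form \<open>a I - b S\<close>, whose
  determinant is the norm form of the Gaussian integers. The four elements correspond to the
  units.\<close>

lemma centralizer_S_mat:
  "centralizer SL2Z S_mat = {mat2 1 0 0 1, mat2 (-1) 0 0 (-1), S_mat, - S_mat}" (is "_ = ?R")
proof
  show "centralizer SL2Z S_mat \<subseteq> ?R"
  proof
    fix h assume "h \<in> centralizer SL2Z S_mat"
    then have h: "h \<in> carrier SL2Z" "h \<otimes>\<^bsub>SL2Z\<^esub> S_mat = S_mat \<otimes>\<^bsub>SL2Z\<^esub> h"
      by (auto simp: centralizer_def)
    obtain a b c d where abcd: "h = mat2 a b c d" "a * d - b * c = 1"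
      using h(1) by (rule SL2Z_cases)
    have cd: "c = - b" "d = a"
      using h(2) unfolding abcd(1) S_mat_def SL2Z_mult_mat2 mat2_eq_iff by linarith+
    have s: "a\<^sup>2 + b\<^sup>2 = 1"
      using abcd(2) by (simp add: cd power2_eq_square)
    have "a\<^sup>2 \<le> 1" "b\<^sup>2 \<le> 1"
      using s zero_le_power2[of a] zero_le_power2[of b] by linarith+
    then have "\<bar>a\<bar> \<le> 1" "\<bar>b\<bar> \<le> 1"
      by (simp_all add: abs_square_le_1)
    then have "a = -1 \<or> a = 0 \<or> a = 1" "b = -1 \<or> b = 0 \<or> b = 1"
      by linarith+
    with s show "h \<in> ?R"
      by (auto simp: S_mat_def abcd(1) cd)
  qed
qed (auto simp: centralizer_def S_mat_def)

text \<open>The same argument with the Eisenstein integers: the determinant becomes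
  \<open>a^2 - a b + b^2\<close>, which represents 1 by the six units only.\<close>

lemma centralizer_ST:
  "centralizer SL2Z (mat2 0 (-1) 1 1) =
     {mat2 1 0 0 1, mat2 (-1) 0 0 (-1), mat2 0 (-1) 1 1, mat2 0 1 (-1) (-1),
      mat2 (-1) (-1) 1 0, mat2 1 1 (-1) 0}" (is "_ = ?R")
proof
  show "centralizer SL2Z (mat2 0 (-1) 1 1) \<subseteq> ?R"
  proof
    fix h assume "h \<in> centralizer SL2Z (mat2 0 (-1) 1 1)"
    then have h: "h \<in> carrier SL2Z"
        "h \<otimes>\<^bsub>SL2Z\<^esub> mat2 0 (-1) 1 1 = mat2 0 (-1) 1 1 \<otimes>\<^bsub>SL2Z\<^esub> h"
      by (auto simp: centralizer_def)
    obtain a b c d where abcd: "h = mat2 a b c d" "a * d - b * c = 1"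
      using h(1) by (rule SL2Z_cases)
    have cd: "c = - b" "d = a - b"
      using h(2) unfolding abcd(1) SL2Z_mult_mat2 mat2_eq_iff by linarith+
    have s: "a\<^sup>2 - a * b + b\<^sup>2 = 1"
      using abcd(2) by (simp add: cd power2_eq_square algebra_simps)
    \<comment> \<open>Four times the quadratic form, with the square completed in either variable,
      bounds both entries.\<close>
    have "3 * b\<^sup>2 = 4 - (2 * a - b)\<^sup>2" "3 * a\<^sup>2 = 4 - (2 * b - a)\<^sup>2"
      using s by algebra+
    moreover have "(2 * a - b)\<^sup>2 \<ge> 0" "(2 * b - a)\<^sup>2 \<ge> 0"
      by simp_all
    ultimately have "3 * b\<^sup>2 \<le> 4" "3 * a\<^sup>2 \<le> 4"
      by simp_all
    then have "a\<^sup>2 \<le> 1" "b\<^sup>2 \<le> 1"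
      by linarith+
    then have "\<bar>a\<bar> \<le> 1" "\<bar>b\<bar> \<le> 1"
      by (simp_all add: abs_square_le_1)
    then have "a = -1 \<or> a = 0 \<or> a = 1" "b = -1 \<or> b = 0 \<or> b = 1"
      by linarith+
    with s show "h \<in> ?R"
      by (auto simp: abcd(1) cd)
  qed
qed (auto simp: centralizer_def)

lemma lcoset_S_mat:
  assumes "g \<in> carrier SL2Z"
  shows "g <#\<^bsub>SL2Z\<^esub> centralizer SL2Z S_mat =
    {g, - g, g \<otimes>\<^bsub>SL2Z\<^esub> S_mat, - (g \<otimes>\<^bsub>SL2Z\<^esub> S_mat)}"
  unfolding l_coset_image centralizer_S_mat unfolding S_mat_def
  by (cases g rule: mat2_exhaust) auto

lemma lcoset_ST:
  assumes "g \<in> carrier SL2Z" "ST = S_mat \<otimes>\<^bsub>SL2Z\<^esub> T_mat"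
  shows "g <#\<^bsub>SL2Z\<^esub> centralizer SL2Z ST =
    {g, - g, g \<otimes>\<^bsub>SL2Z\<^esub> ST, - (g \<otimes>\<^bsub>SL2Z\<^esub> ST),
     g \<otimes>\<^bsub>SL2Z\<^esub> (ST [^]\<^bsub>SL2Z\<^esub> (2::nat)), - (g \<otimes>\<^bsub>SL2Z\<^esub> (ST [^]\<^bsub>SL2Z\<^esub> (2::nat)))}"
proof -
  have ST: "ST = mat2 0 (-1) 1 1"
    by (simp add: assms S_mat_def T_mat_def)
  have ST2: "ST [^]\<^bsub>SL2Z\<^esub> (2::nat) = mat2 (-1) (-1) 1 0"
    by (simp add: numeral_2_eq_2 ST SL2Z_one)
  show ?thesis
    unfolding ST2 unfolding ST
    by (cases g rule: mat2_exhaust) (auto simp: l_coset_image centralizer_ST)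
qed

lemma centralizer_T_mat:
  "h \<in> centralizer SL2Z T_mat \<longleftrightarrow> (\<exists>k. h = T_pow k \<or> h = - T_pow k)"
proof
  assume "h \<in> centralizer SL2Z T_mat"
  then obtain a b d where h: "h = mat2 a b 0 d" "a * d = 1" "a = d"
    unfolding centralizer_def by (auto simp: T_mat_def elim!: SL2Z_cases)
  \<comment> \<open>The diagonal entries are both 1 or both -1; the factor \<open>a\<close> absorbs
    this sign into the exponent.\<close>
  then have "h = T_pow (a * b) \<or> h = - T_pow (a * b)"
    by (auto simp: T_pow_eq zmult_eq_1_iff)
  then show "\<exists>k. h = T_pow k \<or> h = - T_pow k" ..
qed (auto simp: centralizer_def T_pow_eq, simp_all add: T_mat_def)

text \<open>Parallel first columns mean that both matrices send infinity to the same point, so they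
  differ by an element of its stabilizer.\<close>

lemma eq_up_to_T_pow_if_parallel:
  assumes "a * d - b * c = 1" "a' * d' - b' * c' = 1" "a * c' = a' * c"
  shows "\<exists>l. mat2 a' b' c' d' = mat2 a b c d \<otimes>\<^bsub>SL2Z\<^esub> T_pow l \<or>
             mat2 a' b' c' d' = - (mat2 a b c d \<otimes>\<^bsub>SL2Z\<^esub> T_pow l)"
proof -
  \<comment> \<open>The inverse of the first matrix times the second has rows \<open>e, k\<close>
    and \<open>0, f\<close>; the zero is the assumption that the columns are parallel.\<close>
  define e f k where efk: "e = d * a' - b * c'" "f = a * d' - c * b'" "k = d * b' - b * d'"
  have ef: "e * f = 1"
    unfolding efk using assms by algebra
  have eqs: "a' = a * e" "c' = c * e" "b' = a * k + b * f" "d' = c * k + d * f"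
    unfolding efk using assms by algebra+
  consider "e = 1" "f = 1" | "e = -1" "f = -1"
    using ef by (auto simp: zmult_eq_1_iff)
  then show ?thesis
  proof cases
    case 1
    then show ?thesis
      unfolding eqs by (intro exI[of _ k]) (simp add: T_pow_eq)
  next
    case 2
    then show ?thesis
      unfolding eqs by (intro exI[of _ "- k"]) (simp add: T_pow_eq)
  qed
qed

section \<open>Existence and uniqueness of regular continued fractions\<close>

text \<open>Regularity without reference to a value; this condition passes to nonempty tails and so
  suits induction.\<close>

definition cf_digits :: "int list \<Rightarrow> bool" where
  "cf_digits as \<longleftrightarrow> as \<noteq> [] \<and> (\<forall>a \<in> set (tl as). a > 0) \<and> (length as \<ge> 2 \<longrightarrow> last as > 1)"

lemma is_regular_cf_iff: "is_regular_cf r as \<longleftrightarrow> cf_digits as \<and> cf_value as = r"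
  by (auto simp: is_regular_cf_def cf_digits_def)

lemma cf_digits_singleton [simp]: "cf_digits [a]"
  by (simp add: cf_digits_def)

lemma cf_digits_Cons_Cons [simp]:
  "cf_digits (a # b # bs) \<longleftrightarrow> cf_digits (b # bs) \<and> b > 0 \<and> (bs = [] \<longrightarrow> b > 1)"
  by (cases bs) (auto simp: cf_digits_def)

text \<open>A one-element tail exceeds 1 by the convention on the last digit; a longer one is a
  digit at least 1 plus a positive reciprocal.\<close>

lemma cf_value_gt_1:
  "cf_digits (a # b # bs) \<Longrightarrow> cf_value (b # bs) > 1"
proof (induction bs arbitrary: a b)
  case (Cons c cs)
  then have "1 / cf_value (c # cs) > 0"
    by (metis cf_digits_Cons_Cons zero_less_divide_1_iff less_trans zero_less_one)
  moreover have "of_int b \<ge> (1 :: rat)"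
    using Cons.prems by simp
  ultimately show ?case
    unfolding cf_value.simps by linarith
qed simp

text \<open>What follows the first digit is the reciprocal of a number above 1, hence lies strictly
  between 0 and 1.\<close>

lemma floor_cf_value: "cf_digits as \<Longrightarrow> \<lfloor>cf_value as\<rfloor> = hd as"
proof (induction as rule: cf_value.induct)
  case (3 a b bs)
  have "cf_value (b # bs) > 1"
    using 3(2) by (rule cf_value_gt_1)
  then show ?case
    by (simp add: floor_eq_iff)
qed (auto simp: cf_digits_def)

text \<open>The floor recovers the first digit, and the remainder determines the value of the tail.
  A single digit cannot match a longer list, since its remainder is 0.\<close>

lemma cf_value_inj:
  "cf_digits as \<Longrightarrow> cf_digits bs \<Longrightarrow> cf_value as = cf_value bs \<Longrightarrow> as = bs"
proof (induction as arbitrary: bs rule: cf_value.induct)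
  case (2 a)
  show ?case
  proof (cases bs rule: cf_value.cases)
    case (3 x y ys)
    then show ?thesis
      using 2 cf_value_gt_1[of x y ys] floor_cf_value[of bs] floor_of_int[of a]
      by (metis add_cancel_right_right cf_value.simps(2,3) divide_eq_0_iff list.sel(1)
          not_one_less_zero zero_neq_one)
  qed (use 2 in \<open>auto simp: cf_digits_def\<close>)
next
  case (3 a b as)
  have hd: "a = hd bs"
    using "3.prems" by (metis floor_cf_value list.sel(1))
  have gt: "cf_value (b # as) > 1"
    using "3.prems"(1) by (rule cf_value_gt_1)
  show ?case
  proof (cases bs rule: cf_value.cases)
    case 1
    then show ?thesis using 3 by (simp add: cf_digits_def)
  next
    case (2 x)
    then show ?thesis using 3 hd gt by simp
  next
    case (3 x y ys)
    then show ?thesis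
      using "3.IH"[of "y # ys"] "3.prems" hd by simp
  qed
qed (simp add: cf_digits_def)

text \<open>This is the Euclidean algorithm, as an induction on the denominator.\<close>

lemma is_regular_cf_exists: "\<exists>as. is_regular_cf r as"
proof -
  have "\<exists>as. is_regular_cf (of_int p / of_nat q) as" if "q > 0" for p :: int and q :: nat
    using that
  proof (induction q arbitrary: p rule: less_induct)
    case (less q)
    \<comment> \<open>The remainder \<open>m\<close> is the denominator of the next fraction
      \<open>q / m\<close>, whose expansion supplies the tail.\<close>
    define m where "m = nat (p mod int q)"
    have m: "m < q" "int m = p mod int q"
      using less.prems by (auto simp: m_def nat_less_iff)
    have p: "p = int q * (p div int q) + int m"
      using m by simp
    have val: "(of_int p / of_nat q :: rat) = of_int (p div int q) + of_nat m / of_nat q"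
      using less.prems by (subst p) (simp add: field_simps)
    show ?case
    proof (cases "m = 0")
      case True
      with val have "is_regular_cf (of_int p / of_nat q) [p div int q]"
        by (simp add: is_regular_cf_iff)
      then show ?thesis ..
    next
      case False
      then obtain as where as: "cf_digits as" "cf_value as = of_nat q / of_nat m"
        using less.IH[of m "int q"] m by (auto simp: is_regular_cf_iff)
      \<comment> \<open>This makes the first digit of the tail positive, and greater than 1 if it is
        the only one.\<close>
      have gt: "cf_value as > 1"
        using as m False by simp
      obtain b bs where bs: "as = b # bs"
        using as(1) by (cases as) (auto simp: cf_digits_def)
      have "b > 0"
        using floor_cf_value[OF as(1)] gt bs
        by (metis list.sel(1) one_le_floor less_imp_le zero_less_one order_less_le_trans)
      then have "is_regular_cf (of_int p / of_nat q) ((p div int q) # as)"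
        using as gt val bs by (auto simp: is_regular_cf_iff)
      then show ?thesis ..
    qed
  qed
  moreover obtain p q where "q > 0" "r = of_int p / of_int q"
    by (metis quotient_of_div quotient_of_denom_pos surj_pair)
  ultimately show ?thesis
    by (metis of_int_of_nat_eq zero_less_imp_eq_int)
qed

lemma regular_cf: "is_regular_cf r (regular_cf r)"
proof -
  have "\<exists>!as. is_regular_cf r as"
    using is_regular_cf_exists[of r] cf_value_inj by (auto simp: is_regular_cf_iff)
  then show ?thesis
    unfolding regular_cf_def by (rule theI')
qed

section \<open>The image of infinity under \<open>N_mat r\<close>\<close>

text \<open>The sign is an argument instead of the parity of a position, so that the rest of the
  word is again such a word, with the opposite starting sign.\<close>

fun alternating_word :: "int \<Rightarrow> int list \<Rightarrow> int^2^2" where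
  "alternating_word e [] = \<one>\<^bsub>SL2Z\<^esub>"
| "alternating_word e (a # as) =
     T_pow (e * a) \<otimes>\<^bsub>SL2Z\<^esub> S_mat \<otimes>\<^bsub>SL2Z\<^esub> alternating_word (- e) as"

lemma cf_word_eq_alternating_word: "cf_word as = alternating_word 1 as"
proof -
  \<comment> \<open>Generalized over the starting sign, because passing to the tail shifts every
    index by one.\<close>
  have "foldr (\<lambda>i M. T_pow (e * (-1) ^ i * as ! i) \<otimes>\<^bsub>SL2Z\<^esub> S_mat \<otimes>\<^bsub>SL2Z\<^esub> M)
          [0..<length as] \<one>\<^bsub>SL2Z\<^esub> = alternating_word e as" for e
  proof (induction as arbitrary: e)
    case (Cons a as)
    have "[0..<length (a # as)] = 0 # map Suc [0..<length as]"
      by (simp add: upt_conv_Cons map_Suc_upt del: upt_Suc)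
    then show ?case
      using Cons.IH[of "- e"] by (simp add: foldr_map comp_def del: upt_Suc)
  qed simp
  from this[of 1] show ?thesis
    by (simp add: cf_word_def)
qed

text \<open>As Moebius transformations, \<open>T\<^sup>e\<^sup>a S\<close> maps \<open>- e v\<close> to \<open>e (a + 1 / v)\<close>, so the
  alternating word maps infinity (the first column) to \<open>e\<close> times the value of the continued
  fraction.\<close>

lemma alternating_word_column:
  assumes "e * e = 1" "cf_digits as"
  shows "\<exists>a b c d. alternating_word e as = mat2 a b c d \<and> a * d - b * c = 1 \<and> c \<noteq> 0 \<and>
           of_int a = of_int (e * c) * cf_value as"
  using assms
proof (induction as arbitrary: e rule: cf_value.induct)
  case (2 x)
  then show ?case
    by (simp add: T_pow_eq S_mat_def SL2Z_one)
next
  case (3 x y ys)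
  obtain a b c d where abcd: "alternating_word (- e) (y # ys) = mat2 a b c d" "a * d - b * c = 1"
      "c \<noteq> 0" "of_int a = of_int (- e * c) * cf_value (y # ys)"
    using "3.IH"[of "- e"] "3.prems" by auto
  have v: "cf_value (y # ys) > 1"
    using "3.prems"(2) by (rule cf_value_gt_1)
  have "e \<noteq> 0"
    using "3.prems"(1) by auto
  \<comment> \<open>\<open>a\<close> becomes the lower left entry of the longer word.\<close>
  with abcd v have "a \<noteq> 0"
    by auto
  have ee: "of_int e * of_int e = (1 :: rat)"
    using "3.prems"(1) by (metis of_int_1 of_int_mult)
  have "alternating_word e (x # y # ys) = mat2 (e * x * a - c) (e * x * b - d) a b"
    unfolding alternating_word.simps(2)[of e x] abcd(1) by (simp add: T_pow_eq S_mat_def)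
  moreover have "(e * x * a - c) * b - (e * x * b - d) * a = 1"
    using abcd(2) by (simp add: algebra_simps)
  moreover have "(of_int (e * x * a - c) :: rat) = of_int (e * a) * cf_value (x # y # ys)"
  proof -
    \<comment> \<open>Multiplied by \<open>e\<close>, this expresses \<open>- c\<close> as
      \<open>e a / v\<close> with \<open>v\<close> the value of the tail, which turns
      \<open>e x a - c\<close> into \<open>e a (x + 1 / v)\<close>.\<close>
    have "of_int a / cf_value (y # ys) = - of_int e * of_int c"
      using abcd(4) v by simp
    then have "of_int e * of_int a / cf_value (y # ys) = - (of_int e * of_int e) * of_int c"
      by (simp add: mult.assoc times_divide_eq_right[symmetric] del: times_divide_eq_right)
    then show ?thesis
      using ee by (simp add: algebra_simps)
  qed
  ultimately show ?case
    using \<open>a \<noteq> 0\<close> by blast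
qed (simp add: cf_digits_def)

lemma N_mat_column:
  obtains a b c d where "N_mat r = mat2 a b c d" "a * d - b * c = 1" "c \<noteq> 0"
    "of_int a = r * of_int c"
  using alternating_word_column[of 1 "regular_cf r"] regular_cf[of r]
  by (auto simp: N_mat_def cf_word_eq_alternating_word is_regular_cf_iff mult.commute)

lemma N_mat_closed: "N_mat r \<in> carrier SL2Z"
  by (rule N_mat_column[of r]) simp

section \<open>Factorization through \<open>N_mat r\<close> and powers of \<open>T_mat\<close>, up
  to sign\<close>

lemma T_pow_column:
  assumes "a * d = 1"
  shows "\<exists>l. mat2 a b 0 d = T_pow l \<or> mat2 a b 0 d = - T_pow l"
  using eq_up_to_T_pow_if_parallel[of 1 1 0 0 a d b 0] assms
  by (simp add: T_pow_eq)

lemma eq_up_to_N_mat_T_pow: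
  assumes "a * d - b * c = 1" "c \<noteq> 0" "of_int a = r * of_int c"
  shows "\<exists>l. mat2 a b c d = N_mat r \<otimes>\<^bsub>SL2Z\<^esub> T_pow l \<or>
             mat2 a b c d = - (N_mat r \<otimes>\<^bsub>SL2Z\<^esub> T_pow l)"
proof (rule N_mat_column[of r])
  fix a' b' c' d'
  assume N: "N_mat r = mat2 a' b' c' d'" "a' * d' - b' * c' = 1" "c' \<noteq> 0" "of_int a' = r * of_int c'"
  have "(of_int (a' * c) :: rat) = of_int (a * c')"
    using assms N by simp
  then have "a' * c = a * c'"
    by (simp only: of_int_eq_iff)
  then show ?thesis
    unfolding N(1) using eq_up_to_T_pow_if_parallel N(2) assms(1) by blast
qed

text \<open>Right multiplication by \<open>T_pow l\<close> keeps the first column, whose quotient is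
  \<open>r\<close>; cancelling \<open>N_mat r\<close> then yields \<open>l\<close>. Equality up to a
  minus sign would also give the same \<open>r\<close>, so the nonzero lower left entry of
  \<open>N_mat r\<close> would equal its own negative.\<close>

lemma N_mat_T_pow_eq_iff:
  "N_mat r \<otimes>\<^bsub>SL2Z\<^esub> T_pow l = N_mat r' \<otimes>\<^bsub>SL2Z\<^esub> T_pow l' \<longleftrightarrow> r = r' \<and> l = l'"
  "N_mat r \<otimes>\<^bsub>SL2Z\<^esub> T_pow l \<noteq> - (N_mat r' \<otimes>\<^bsub>SL2Z\<^esub> T_pow l')"
proof -
  obtain a b c d where N: "N_mat r = mat2 a b c d" "a * d - b * c = 1" "c \<noteq> 0"
    "of_int a = r * of_int c" by (rule N_mat_column)
  obtain a' b' c' d' where N': "N_mat r' = mat2 a' b' c' d'" "a' * d' - b' * c' = 1" "c' \<noteq> 0"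
    "of_int a' = r' * of_int c'" by (rule N_mat_column)
  have r: "r = of_int a / of_int c" "r' = of_int a' / of_int c'"
    using N(3,4) N'(3,4) by (simp_all add: field_simps)
  have prod: "N_mat r \<otimes>\<^bsub>SL2Z\<^esub> T_pow l = mat2 a (a * l + b) c (c * l + d)"
    "N_mat r' \<otimes>\<^bsub>SL2Z\<^esub> T_pow l' = mat2 a' (a' * l' + b') c' (c' * l' + d')"
    by (simp_all add: N(1) N'(1) T_pow_eq)
  show "N_mat r \<otimes>\<^bsub>SL2Z\<^esub> T_pow l = N_mat r' \<otimes>\<^bsub>SL2Z\<^esub> T_pow l' \<longleftrightarrow> r = r' \<and> l = l'"
  proof
    assume eq: "N_mat r \<otimes>\<^bsub>SL2Z\<^esub> T_pow l = N_mat r' \<otimes>\<^bsub>SL2Z\<^esub> T_pow l'"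
    then have "a = a'" "c = c'"
      unfolding prod mat2_eq_iff by blast+
    then have "r = r'"
      unfolding r by simp
    moreover from this eq have "T_pow l = T_pow l'"
      using SL2Z.inj_on_cmult[OF N_mat_closed[of r]] T_pow_closed by (metis inj_onD)
    ultimately show "r = r' \<and> l = l'"
      by (simp add: T_pow_eq)
  qed simp
  show "N_mat r \<otimes>\<^bsub>SL2Z\<^esub> T_pow l \<noteq> - (N_mat r' \<otimes>\<^bsub>SL2Z\<^esub> T_pow l')"
  proof
    assume "N_mat r \<otimes>\<^bsub>SL2Z\<^esub> T_pow l = - (N_mat r' \<otimes>\<^bsub>SL2Z\<^esub> T_pow l')"
    then have ac: "a = - a'" "c = - c'"
      unfolding prod uminus_mat2 mat2_eq_iff by blast+
    then have "r = r'"
      unfolding r by simp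
    then have "c = c'"
      using N(1) N'(1) by simp
    with ac(2) N(3) show False
      by simp
  qed
qed

lemma N_mat_T_pow_cover:
  assumes "mat2 a b c d \<in> carrier SL2Z" "c \<noteq> 0"
  shows "\<exists>l. mat2 a b c d = N_mat (of_int a / of_int c) \<otimes>\<^bsub>SL2Z\<^esub> T_pow l \<or>
             - mat2 a b c d = N_mat (of_int a / of_int c) \<otimes>\<^bsub>SL2Z\<^esub> T_pow l"
proof -
  have "(of_int a :: rat) = of_int a / of_int c * of_int c"
    using assms(2) by simp
  then obtain l where "mat2 a b c d = N_mat (of_int a / of_int c) \<otimes>\<^bsub>SL2Z\<^esub> T_pow l \<or>
      mat2 a b c d = - (N_mat (of_int a / of_int c) \<otimes>\<^bsub>SL2Z\<^esub> T_pow l)"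
    using eq_up_to_N_mat_T_pow assms by (metis mat2_in_SL2Z)
  then show ?thesis
    by (metis minus_minus)
qed

section \<open>Cosets of the centralizer of \<open>S_mat\<close>\<close>

text \<open>\<open>g\<close> and \<open>g S\<close> send infinity to points with denominators
  \<open>c\<close> and \<open>d\<close>, which are not both 0.\<close>

lemma lcoset_S_mat_meets:
  assumes "C \<in> lcosets\<^bsub>SL2Z\<^esub> (centralizer SL2Z S_mat)"
  shows "{N_mat r \<otimes>\<^bsub>SL2Z\<^esub> T_pow l | r l. True} \<inter> C \<noteq> {}"
proof -
  obtain g where g: "g \<in> carrier SL2Z" "C = g <#\<^bsub>SL2Z\<^esub> centralizer SL2Z S_mat"
    using assms by (auto simp: LCOSETS_def)
  obtain a b c d where abcd: "g = mat2 a b c d" "a * d - b * c = 1"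
    using g(1) by (rule SL2Z_cases)
  have C: "g \<in> C" "- g \<in> C" "mat2 b (- a) d (- c) \<in> C" "- mat2 b (- a) d (- c) \<in> C"
    unfolding g(2) lcoset_S_mat[OF g(1)] by (auto simp: abcd S_mat_def)
  show ?thesis
  proof (cases "c = 0")
    case False
    then show ?thesis
      using N_mat_T_pow_cover[of a b c d] g(1) abcd(1) C(1,2) by blast
  next
    case True
    with abcd have "d \<noteq> 0"
      by auto
    moreover have "mat2 b (- a) d (- c) \<in> carrier SL2Z"
      using abcd(2) by (simp add: algebra_simps)
    ultimately show ?thesis
      using N_mat_T_pow_cover[of b "- a" d "- c"] C(3,4) by blast
  qed
qed

text \<open>Puts the pairs \<open>g\<close>, \<open>g S\<close> into the coset form that
  \<open>removing_repetitions_lcosets\<close> expects. As \<open>L\<close> never contains both an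
  element and its negative, it meets each coset in at most two elements.\<close>

lemma S_mat_repetitions:
  assumes L: "L \<subseteq> carrier SL2Z" and no_neg: "\<And>g. g \<in> L \<Longrightarrow> - g \<notin> L"
  shows "{{g, g \<otimes>\<^bsub>SL2Z\<^esub> S_mat} | g. g \<in> L \<and> g \<otimes>\<^bsub>SL2Z\<^esub> S_mat \<in> L} =
    {L \<inter> C | C. C \<in> lcosets\<^bsub>SL2Z\<^esub> (centralizer SL2Z S_mat) \<and> (\<exists>g \<in> L \<inter> C. \<exists>h \<in> L \<inter> C. g \<noteq> h)}"
    (is "?K = ?K'")
proof -
  let ?H = "centralizer SL2Z S_mat"
  have pair: "L \<inter> (g <#\<^bsub>SL2Z\<^esub> ?H) = {g, g \<otimes>\<^bsub>SL2Z\<^esub> S_mat}" "g \<noteq> g \<otimes>\<^bsub>SL2Z\<^esub> S_mat"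
    if g: "g \<in> L" "g \<otimes>\<^bsub>SL2Z\<^esub> S_mat \<in> L" for g
  proof -
    have gc: "g \<in> carrier SL2Z"
      using g(1) L by blast
    show "L \<inter> (g <#\<^bsub>SL2Z\<^esub> ?H) = {g, g \<otimes>\<^bsub>SL2Z\<^esub> S_mat}"
      unfolding lcoset_S_mat[OF gc] using g no_neg[OF g(1)] no_neg[OF g(2)] by simp
    show "g \<noteq> g \<otimes>\<^bsub>SL2Z\<^esub> S_mat"
    proof
      assume eq: "g = g \<otimes>\<^bsub>SL2Z\<^esub> S_mat"
      obtain a b c d where abcd: "g = mat2 a b c d" "a * d - b * c = 1"
        using gc by (rule SL2Z_cases)
      have "g \<otimes>\<^bsub>SL2Z\<^esub> S_mat = mat2 b (- a) d (- c)"
        by (simp add: abcd(1) S_mat_def)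
      from trans[OF trans[OF abcd(1)[symmetric] eq] this] have "a = b" "b = - a"
        unfolding mat2_eq_iff by blast+
      then have "a = 0" "b = 0"
        by linarith+
      then show False
        using abcd(2) by simp
    qed
  qed
  show ?thesis
  proof (intro Set.equalityI subsetI)
    fix D assume "D \<in> ?K"
    then obtain g where g: "D = {g, g \<otimes>\<^bsub>SL2Z\<^esub> S_mat}" "g \<in> L" "g \<otimes>\<^bsub>SL2Z\<^esub> S_mat \<in> L"
      by blast
    have "g <#\<^bsub>SL2Z\<^esub> ?H \<in> lcosets\<^bsub>SL2Z\<^esub> ?H"
      using g(2) L unfolding LCOSETS_def by blast
    moreover have "D = L \<inter> (g <#\<^bsub>SL2Z\<^esub> ?H)"
      using pair(1)[OF g(2,3)] g(1) by simp
    moreover from this have "\<exists>x \<in> L \<inter> (g <#\<^bsub>SL2Z\<^esub> ?H). \<exists>y \<in> L \<inter> (g <#\<^bsub>SL2Z\<^esub> ?H). x \<noteq> y"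
      using pair(2)[OF g(2,3)] g(1) by (metis insertI1 insertI2)
    ultimately show "D \<in> ?K'"
      by (intro CollectI exI conjI)
  next
    fix D assume "D \<in> ?K'"
    then obtain C g h where C: "D = L \<inter> C" "C \<in> lcosets\<^bsub>SL2Z\<^esub> ?H" and
      gh: "g \<in> L" "g \<in> C" "h \<in> L" "h \<in> C" "g \<noteq> h"
      by blast
    have C_eq: "C = x <#\<^bsub>SL2Z\<^esub> ?H" if "x \<in> C" for x
    proof -
      obtain y where "y \<in> carrier SL2Z" "C = y <#\<^bsub>SL2Z\<^esub> ?H"
        using C(2) by (auto simp: LCOSETS_def)
      then show ?thesis
        using SL2Z.l_repr_independence[OF _ _ SL2Z.centralizer_subgroup[OF S_mat_closed]] that
        by blast
    qed
    have gc: "g \<in> carrier SL2Z"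
      using gh(1) L by blast
    have "h \<in> {g, - g, g \<otimes>\<^bsub>SL2Z\<^esub> S_mat, - (g \<otimes>\<^bsub>SL2Z\<^esub> S_mat)}"
      using C_eq[OF gh(2)] gh(4) lcoset_S_mat[OF gc] by simp
    then consider "h = g \<otimes>\<^bsub>SL2Z\<^esub> S_mat" | "h = - (g \<otimes>\<^bsub>SL2Z\<^esub> S_mat)"
      using gh(3,5) no_neg[OF gh(1)] by blast
    then show "D \<in> ?K"
    proof cases
      case 1
      then have "D = {g, g \<otimes>\<^bsub>SL2Z\<^esub> S_mat}" "g \<otimes>\<^bsub>SL2Z\<^esub> S_mat \<in> L"
        using pair(1)[of g] C_eq[OF gh(2)] C(1) gh(1,3) by simp_all
      then show ?thesis
        using gh(1) by blast
    next
      case 2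
      \<comment> \<open>The square of \<open>S_mat\<close> is \<open>- I\<close>, so the same pair
        is obtained starting from \<open>h\<close>.\<close>
      then have "h \<otimes>\<^bsub>SL2Z\<^esub> S_mat = g"
        by (cases g rule: mat2_exhaust) (simp add: S_mat_def)
      then have "D = {h, h \<otimes>\<^bsub>SL2Z\<^esub> S_mat}" "h \<otimes>\<^bsub>SL2Z\<^esub> S_mat \<in> L"
        using pair(1)[of h] C_eq[OF gh(4)] C(1) gh(1,3) by simp_all
      then show ?thesis
        using gh(3) by blast
    qed
  qed
qed

section \<open>Cosets of the centralizer of \<open>ST\<close>\<close>

text \<open>Either infinity is fixed, which gives a power of \<open>T_mat\<close> up to sign, or it
  goes to \<open>a / c\<close>. This is in lowest terms, so it is an integer only for
  \<open>c\<close> equal to 1 or -1.\<close>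

lemma T_pow_N_mat_cover:
  assumes g: "mat2 a b c d \<in> carrier SL2Z" and c: "\<bar>c\<bar> \<noteq> 1"
    and L': "L' = {T_pow m | m. True} \<union> {N_mat r \<otimes>\<^bsub>SL2Z\<^esub> T_pow l | r l. r \<notin> \<int>}"
  shows "mat2 a b c d \<in> L' \<or> - mat2 a b c d \<in> L'"
proof (cases "c = 0")
  case True
  then show ?thesis
    using T_pow_column[of a d b] g unfolding L' by (metis (mono_tags, lifting) CollectI UnI1
        diff_zero mat2_in_SL2Z minus_minus mult_zero_right)
next
  case False
  have "of_int a / of_int c \<notin> (\<int> :: rat set)"
  proof
    assume "of_int a / of_int c \<in> (\<int> :: rat set)"
    then obtain k where "(of_int a :: rat) / of_int c = of_int k"
      by (auto elim: Ints_cases)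
    then have "(of_int a :: rat) = of_int (k * c)"
      using False by (simp add: field_simps)
    then have "a = k * c"
      by (simp only: of_int_eq_iff)
    \<comment> \<open>If \<open>c\<close> divides \<open>a\<close>, then it divides the
      determinant.\<close>
    then have "c * (k * d - b) = 1"
      using g by (simp add: algebra_simps)
    then show False
      using c by (auto simp: zmult_eq_1_iff)
  qed
  then show ?thesis
    using N_mat_T_pow_cover[OF g False] unfolding L' by blast
qed

text \<open>The three points to which \<open>g\<close>, \<open>g ST\<close> and \<open>g (ST)\<^sup>2\<close> send infinity have denominators
  \<open>c\<close>, \<open>d\<close> and \<open>d - c\<close>, and these cannot all be \<open>1\<close> or \<open>-1\<close>.\<close>

lemma lcoset_ST_meets:
  assumes "C \<in> lcosets\<^bsub>SL2Z\<^esub> (centralizer SL2Z (mat2 0 (-1) 1 1))"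
    and L': "L' = {T_pow m | m. True} \<union> {N_mat r \<otimes>\<^bsub>SL2Z\<^esub> T_pow l | r l. r \<notin> \<int>}"
  shows "L' \<inter> C \<noteq> {}"
proof -
  obtain g where g: "g \<in> carrier SL2Z" "C = g <#\<^bsub>SL2Z\<^esub> centralizer SL2Z (mat2 0 (-1) 1 1)"
    using assms by (auto simp: LCOSETS_def)
  obtain a b c d where abcd: "g = mat2 a b c d" "a * d - b * c = 1"
    using g(1) by (rule SL2Z_cases)
  \<comment> \<open>These are \<open>g\<close>, \<open>g ST\<close> and \<open>g (ST)^2\<close>,
    each with its negative.\<close>
  have C: "mat2 a b c d \<in> C" "- mat2 a b c d \<in> C"
    "mat2 b (b - a) d (d - c) \<in> C" "- mat2 b (b - a) d (d - c) \<in> C"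
    "mat2 (b - a) (- a) (d - c) (- c) \<in> C" "- mat2 (b - a) (- a) (d - c) (- c) \<in> C"
    unfolding g(2) l_coset_image centralizer_ST abcd(1) by simp_all
  \<comment> \<open>If \<open>c\<close> and \<open>d\<close> are both 1 or -1, then
    \<open>d - c\<close> is even.\<close>
  consider "\<bar>c\<bar> \<noteq> 1" | "\<bar>d\<bar> \<noteq> 1" | "\<bar>d - c\<bar> \<noteq> 1"
    by linarith
  then show ?thesis
  proof cases
    case 1
    then show ?thesis
      using T_pow_N_mat_cover[OF _ 1 L', of a b d] C(1,2) abcd(2) by auto
  next
    case 2
    then show ?thesis
      using T_pow_N_mat_cover[OF _ 2 L', of b "b - a" "d - c"] C(3,4) abcd(2)
      by (auto simp: algebra_simps)
  next
    case 3
    then show ?thesis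
      using T_pow_N_mat_cover[OF _ 3 L', of "b - a" "- a" "- c"] C(5,6) abcd(2)
      by (auto simp: algebra_simps)
  qed
qed

section \<open>Cosets of the centralizer of \<open>T_mat\<close>\<close>

lemma in_lcoset_T_mat_iff:
  "h \<in> g <#\<^bsub>SL2Z\<^esub> centralizer SL2Z T_mat \<longleftrightarrow>
     (\<exists>k. h = g \<otimes>\<^bsub>SL2Z\<^esub> T_pow k \<or> h = - (g \<otimes>\<^bsub>SL2Z\<^esub> T_pow k))"
proof -
  have neg: "g \<otimes>\<^bsub>SL2Z\<^esub> - T_pow k = - (g \<otimes>\<^bsub>SL2Z\<^esub> T_pow k)" for k
    by (cases g rule: mat2_exhaust) (simp add: T_pow_eq)
  have "h \<in> g <#\<^bsub>SL2Z\<^esub> centralizer SL2Z T_mat \<longleftrightarrow>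
      (\<exists>u k. (u = T_pow k \<or> u = - T_pow k) \<and> h = g \<otimes>\<^bsub>SL2Z\<^esub> u)"
    unfolding l_coset_image image_iff Bex_def centralizer_T_mat by blast
  also have "\<dots> \<longleftrightarrow> (\<exists>k. h = g \<otimes>\<^bsub>SL2Z\<^esub> T_pow k \<or> h = - (g \<otimes>\<^bsub>SL2Z\<^esub> T_pow k))"
    by (simp only: neg[symmetric]) blast
  finally show ?thesis .
qed

text \<open>Elements of the coset of \<open>I\<close> fix infinity, whereas \<open>N_mat r\<close>
  has nonzero lower left entry.\<close>

lemma N_mat_not_in_lcoset_one:
  "N_mat r \<notin> \<one>\<^bsub>SL2Z\<^esub> <#\<^bsub>SL2Z\<^esub> centralizer SL2Z T_mat"
  unfolding in_lcoset_T_mat_iff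
  by (rule N_mat_column[of r]) (auto simp: T_pow_eq SL2Z_one)

lemma N_mat_lcoset_inj:
  assumes "N_mat r' \<in> N_mat r <#\<^bsub>SL2Z\<^esub> centralizer SL2Z T_mat"
  shows "r' = r"
proof -
  \<comment> \<open>The factor \<open>T_pow 0\<close> brings \<open>N_mat r'\<close> into the form
    of the uniqueness lemma.\<close>
  have "N_mat r' = N_mat r' \<otimes>\<^bsub>SL2Z\<^esub> T_pow 0"
    using SL2Z.r_one[OF N_mat_closed] by simp
  then show ?thesis
    using assms N_mat_T_pow_eq_iff[of r' 0 r] unfolding in_lcoset_T_mat_iff by metis
qed

text \<open>A coset is determined by the point to which its elements send infinity: \<open>I\<close>
  serves for infinity and \<open>N_mat r\<close> for \<open>r\<close>.\<close>

lemma left_coset_representatives_T_mat: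
  "left_coset_representatives SL2Z (centralizer SL2Z T_mat)
     ({\<one>\<^bsub>SL2Z\<^esub>} \<union> {N_mat r | r. True})" (is "left_coset_representatives _ ?U ?R")
  unfolding left_coset_representatives_def
proof (intro conjI ballI)
  show "?R \<subseteq> carrier SL2Z"
    using N_mat_closed by auto
next
  fix C assume "C \<in> lcosets\<^bsub>SL2Z\<^esub> ?U"
  then obtain x where x: "x \<in> carrier SL2Z" "C = x <#\<^bsub>SL2Z\<^esub> ?U"
    by (auto simp: LCOSETS_def)
  note U = SL2Z.centralizer_subgroup[OF T_mat_closed]
  obtain a b c d where abcd: "x = mat2 a b c d" "a * d - b * c = 1"
    using x(1) by (rule SL2Z_cases)
  have "\<exists>g\<in>?R. x \<in> g <#\<^bsub>SL2Z\<^esub> ?U"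
  proof (cases "c = 0")
    case True
    then obtain l where "x = T_pow l \<or> x = - T_pow l"
      using T_pow_column[of a d b] abcd by auto
    then have "x \<in> \<one>\<^bsub>SL2Z\<^esub> <#\<^bsub>SL2Z\<^esub> ?U"
      unfolding in_lcoset_T_mat_iff using SL2Z.l_one[OF T_pow_closed] by auto
    then show ?thesis
      by blast
  next
    case False
    have "(of_int a :: rat) = of_int a / of_int c * of_int c"
      using False by simp
    then have "x \<in> N_mat (of_int a / of_int c) <#\<^bsub>SL2Z\<^esub> ?U"
      unfolding in_lcoset_T_mat_iff abcd(1) using eq_up_to_N_mat_T_pow abcd(2) False by blast
    then show ?thesis
      by blast
  qed
  then obtain g where g: "g \<in> ?R" "x \<in> g <#\<^bsub>SL2Z\<^esub> ?U"
    by blast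
  have gc: "g \<in> carrier SL2Z"
    using g(1) N_mat_closed by auto
  have C: "C = g <#\<^bsub>SL2Z\<^esub> ?U"
    unfolding x(2) using SL2Z.l_repr_independence[OF g(2) gc U] by simp
  show "\<exists>!g. g \<in> ?R \<and> g \<in> C"
  proof (rule ex1I[of _ g])
    show "g \<in> ?R \<and> g \<in> C"
      using g(1) SL2Z.lcos_self[OF gc U] C by simp
  next
    fix h assume h: "h \<in> ?R \<and> h \<in> C"
    \<comment> \<open>Membership is needed in both directions, since either of \<open>g\<close> and
      \<open>h\<close> might be \<open>I\<close> with the other one some
      \<open>N_mat r\<close>.\<close>
    then have "g \<in> h <#\<^bsub>SL2Z\<^esub> ?U"
      using SL2Z.l_repr_independence[OF _ gc U] SL2Z.lcos_self[OF gc U] C by blast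
    then show "h = g"
      using g(1) h N_mat_not_in_lcoset_one N_mat_lcoset_inj unfolding C by blast
  qed
qed

theorem theorem4p3:
  fixes L L' :: "(int^2^2) set" and ST :: "int^2^2"
  assumes "L = {N_mat r \<otimes>\<^bsub>SL2Z\<^esub> T_pow l | r l. True}"
    and "L' = {T_pow m | m. True} \<union> {N_mat r \<otimes>\<^bsub>SL2Z\<^esub> T_pow l | r l. r \<notin> \<int>}"
    and "ST = S_mat \<otimes>\<^bsub>SL2Z\<^esub> T_mat"
  shows
   "\<comment> \<open>(1)\<close>
    ((\<forall>a b c d. mat2 a b c d \<in> carrier SL2Z \<longrightarrow>
        mat2 a b c d \<otimes>\<^bsub>SL2Z\<^esub> S_mat = mat2 b (-a) d (-c) \<and>
        mat2 a b c d <#\<^bsub>SL2Z\<^esub> centralizer SL2Z S_mat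
          = mat2 b (-a) d (-c) <#\<^bsub>SL2Z\<^esub> centralizer SL2Z S_mat) \<and>
     (let K = {{g, g \<otimes>\<^bsub>SL2Z\<^esub> S_mat} | g. g \<in> L \<and> g \<otimes>\<^bsub>SL2Z\<^esub> S_mat \<in> L} in
        (\<exists>R. removing_repetitions L K R) \<and>
        (\<forall>R. removing_repetitions L K R \<longrightarrow>
           left_coset_representatives SL2Z (centralizer SL2Z S_mat) R))) \<and>
    \<comment> \<open>(2)\<close>
    ((\<forall>g \<in> carrier SL2Z.
        g <#\<^bsub>SL2Z\<^esub> centralizer SL2Z ST =
          {g, - g, g \<otimes>\<^bsub>SL2Z\<^esub> ST, - (g \<otimes>\<^bsub>SL2Z\<^esub> ST),
           g \<otimes>\<^bsub>SL2Z\<^esub> (ST [^]\<^bsub>SL2Z\<^esub> (2::nat)), - (g \<otimes>\<^bsub>SL2Z\<^esub> (ST [^]\<^bsub>SL2Z\<^esub> (2::nat)))}) \<and>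
     (let K = {L' \<inter> C | C. C \<in> lcosets\<^bsub>SL2Z\<^esub> (centralizer SL2Z ST) \<and>
                          (\<exists>g \<in> L' \<inter> C. \<exists>h \<in> L' \<inter> C. g \<noteq> h)} in
        (\<exists>R. removing_repetitions L' K R) \<and>
        (\<forall>R. removing_repetitions L' K R \<longrightarrow>
           left_coset_representatives SL2Z (centralizer SL2Z ST) R))) \<and>
    \<comment> \<open>(3)\<close>
    left_coset_representatives SL2Z (centralizer SL2Z T_mat)
      ({\<one>\<^bsub>SL2Z\<^esub>} \<union> {N_mat r | r. True})"
proof (intro conjI)
  have L_closed: "L \<subseteq> carrier SL2Z" and L'_closed: "L' \<subseteq> carrier SL2Z"
    unfolding assms using N_mat_closed T_pow_closed by auto
  have no_neg: "- g \<notin> L" if "g \<in> L" for g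
    using that N_mat_T_pow_eq_iff(2)[symmetric] unfolding assms(1) by auto
  have ST: "ST = mat2 0 (-1) 1 1"
    by (simp add: assms S_mat_def T_mat_def)
  then have ST_closed: "ST \<in> carrier SL2Z"
    by simp
  show "\<forall>a b c d. mat2 a b c d \<in> carrier SL2Z \<longrightarrow>
        mat2 a b c d \<otimes>\<^bsub>SL2Z\<^esub> S_mat = mat2 b (-a) d (-c) \<and>
        mat2 a b c d <#\<^bsub>SL2Z\<^esub> centralizer SL2Z S_mat
          = mat2 b (-a) d (-c) <#\<^bsub>SL2Z\<^esub> centralizer SL2Z S_mat"
  proof (intro allI impI conjI)
    fix a b c d assume g: "mat2 a b c d \<in> carrier SL2Z"
    then have h: "mat2 b (-a) d (-c) \<in> carrier SL2Z"
      by (simp add: mult.commute)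
    show gS: "mat2 a b c d \<otimes>\<^bsub>SL2Z\<^esub> S_mat = mat2 b (-a) d (-c)"
      by (simp add: S_mat_def)
    \<comment> \<open>So passing from \<open>g\<close> to \<open>g S\<close> only permutes the four
      elements of the coset.\<close>
    have hS: "mat2 b (-a) d (-c) \<otimes>\<^bsub>SL2Z\<^esub> S_mat = - mat2 a b c d"
      by (simp add: S_mat_def)
    show "mat2 a b c d <#\<^bsub>SL2Z\<^esub> centralizer SL2Z S_mat
          = mat2 b (-a) d (-c) <#\<^bsub>SL2Z\<^esub> centralizer SL2Z S_mat"
      unfolding lcoset_S_mat[OF g] lcoset_S_mat[OF h] gS hS by auto
  qed
  show "let K = {{g, g \<otimes>\<^bsub>SL2Z\<^esub> S_mat} | g. g \<in> L \<and> g \<otimes>\<^bsub>SL2Z\<^esub> S_mat \<in> L} in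
        (\<exists>R. removing_repetitions L K R) \<and>
        (\<forall>R. removing_repetitions L K R \<longrightarrow>
           left_coset_representatives SL2Z (centralizer SL2Z S_mat) R)"
    unfolding Let_def
    \<comment> \<open>\<open>S_mat_repetitions\<close> supplies the coset form of \<open>K\<close>;
      in (2) \<open>K\<close> already has it.\<close>
    by (rule SL2Z.removing_repetitions_lcosets[OF SL2Z.centralizer_subgroup[OF S_mat_closed]
          L_closed _ S_mat_repetitions[OF L_closed no_neg]])
       (simp only: assms(1) lcoset_S_mat_meets not_False_eq_True)
  show "\<forall>g \<in> carrier SL2Z.
        g <#\<^bsub>SL2Z\<^esub> centralizer SL2Z ST =
          {g, - g, g \<otimes>\<^bsub>SL2Z\<^esub> ST, - (g \<otimes>\<^bsub>SL2Z\<^esub> ST),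
           g \<otimes>\<^bsub>SL2Z\<^esub> (ST [^]\<^bsub>SL2Z\<^esub> (2::nat)), - (g \<otimes>\<^bsub>SL2Z\<^esub> (ST [^]\<^bsub>SL2Z\<^esub> (2::nat)))}"
    using lcoset_ST assms(3) by blast
  show "let K = {L' \<inter> C | C. C \<in> lcosets\<^bsub>SL2Z\<^esub> (centralizer SL2Z ST) \<and>
                          (\<exists>g \<in> L' \<inter> C. \<exists>h \<in> L' \<inter> C. g \<noteq> h)} in
        (\<exists>R. removing_repetitions L' K R) \<and>
        (\<forall>R. removing_repetitions L' K R \<longrightarrow>
           left_coset_representatives SL2Z (centralizer SL2Z ST) R)"
    unfolding Let_def
    by (rule SL2Z.removing_repetitions_lcosets[OF SL2Z.centralizer_subgroup[OF ST_closed] L'_closed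
          lcoset_ST_meets[OF _ assms(2)] refl]) (simp only: ST)
  show "left_coset_representatives SL2Z (centralizer SL2Z T_mat)
      ({\<one>\<^bsub>SL2Z\<^esub>} \<union> {N_mat r | r. True})"
    by (rule left_coset_representatives_T_mat)
qed

end
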